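(* Let $r>0$ and $f(x)=r\sin x$. The equation $$x'(t)=-\int_0^1 f(x(t-s))\,ds$$ has a special symmetric periodic solution (SSPS) if and only if $r>\pi^2/2$. When $r>\pi^2/2$, the SSPS is expressed (up to translation in time) as $$x(t)=2\arcsin\left(k\,\mathrm{sn}\left(\sqrt{2r}\,t,k\right)\right),$$ where $k\in(0,1)$ is uniquely determined as the solution of the equation $$\frac{2K(k)}{\sqrt{2r}}=1.$$
   Context: A special symmetric periodic solution (SSPS) of the equation is a differentiable function $x:\mathbb{R}\to\mathbb{R}$ satisfying the equation for all $t\in\mathbb{R}$ that is periodic with minimal period $2$ and satisfies $x(t)+x(t-1)=0$ for all $t\in\mathbb{R}$. $\mathrm{sn}(\cdot,k)$ is the Jacobi elliptic sine function with modulus $k$, and $K(k)=\int_0^{\pi/2}\frac{d\theta}{\sqrt{1-k^2\sin^2\theta}}$, $0\le k<1$, is the complete elliptic integral of the first kind. *)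

theory Defs
  imports "HOL-Analysis.Analysis"
begin

definition solves_dde :: "(real \<Rightarrow> real) \<Rightarrow> (real \<Rightarrow> real) \<Rightarrow> bool" where
  "solves_dde f x \<longleftrightarrow>
     (\<forall>t. (x has_real_derivative - integral {0..1} (\<lambda>s. f (x (t - s)))) (at t))"

definition is_period :: "(real \<Rightarrow> real) \<Rightarrow> real \<Rightarrow> bool" where
  "is_period x p \<longleftrightarrow> 0 < p \<and> (\<forall>t. x (t + p) = x t)"

definition minimal_period :: "(real \<Rightarrow> real) \<Rightarrow> real \<Rightarrow> bool" where
  "minimal_period x p \<longleftrightarrow> is_period x p \<and> (\<forall>q. is_period x q \<longrightarrow> p \<le> q)"

definition SSPS :: "(real \<Rightarrow> real) \<Rightarrow> (real \<Rightarrow> real) \<Rightarrow> bool" where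
  "SSPS f x \<longleftrightarrow> solves_dde f x \<and> minimal_period x 2 \<and> (\<forall>t. x t + x (t - 1) = 0)"

definition elliptic_K :: "real \<Rightarrow> real" where
  "elliptic_K k = (LBINT \<theta>=0..ereal (pi / 2). 1 / sqrt (1 - k\<^sup>2 * (sin \<theta>)\<^sup>2))"

text \<open>
  Incomplete integral of the first kind. The interval integral is oriented, so this is the odd
  extension for negative \<open>\<phi>\<close>.
\<close>

definition elliptic_F :: "real \<Rightarrow> real \<Rightarrow> real" where
  "elliptic_F \<phi> k = (LBINT \<theta>=0..ereal \<phi>. 1 / sqrt (1 - k\<^sup>2 * (sin \<theta>)\<^sup>2))"

text \<open>
  For \<open>0 \<le> k < 1\<close> the map \<open>\<phi> \<mapsto> elliptic_F \<phi> k\<close> is an increasing bijection of the real line. The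
  Jacobi amplitude is its inverse, and \<open>sn\<close> is the sine of the amplitude. The second argument is
  the modulus \<open>k\<close>, not the parameter \<open>k\<^sup>2\<close>.
\<close>

definition jacobi_am :: "real \<Rightarrow> real \<Rightarrow> real" where
  "jacobi_am u k = (THE \<phi>. elliptic_F \<phi> k = u)"

definition jacobi_sn :: "real \<Rightarrow> real \<Rightarrow> real" where
  "jacobi_sn u k = sin (jacobi_am u k)"

end

theory Submission
  imports Defs
begin

text \<open>
  Write \<open>w = sqrt (2 * r)\<close>. Since \<open>x' t = - (integral of r * sin x over [t - 1, t])\<close>, differentiating
  once more and using \<open>x (t - 1) = - x t\<close> gives the pendulum equation \<open>x'' = - w\<^sup>2 * sin x\<close>. Conversely,
  if \<open>x\<close> solves the pendulum equation and \<open>x' (t - 1) = - x' t\<close>, then \<open>x'\<close> is an antiderivative of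
  \<open>- 2 * r * sin x\<close>, so the delayed integral is \<open>(x' (t - 1) - x' t) / 2 = - x' t\<close> and the delay
  equation holds.

  The pendulum is solved explicitly by \<open>2 * arcsin (k * sn (w * t, k))\<close>, an oscillation through \<open>0\<close>
  with initial velocity \<open>2 * k * w\<close>, least period \<open>4 * K k / w\<close> and half-period antisymmetry
  (\<open>pendulum_jacobi\<close>, \<open>jacobi_pendulum_minimal_period\<close>, \<open>jacobi_am_add_2K\<close>). Every SSPS
  is of this form: antisymmetry gives a zero \<open>t0\<close> with positive velocity, which defines \<open>k > 0\<close>. By Rolle the velocity vanishes
  somewhere; conservation of energy then gives \<open>k \<le> 1\<close>, and \<open>k = 1\<close> (the separatrix) is impossible
  because the turning point would be an equilibrium. Uniqueness for the initial value problem
  (\<open>pendulum_unique\<close>) identifies \<open>x\<close> with the explicit solution, and comparing least periods gives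
  \<open>4 * K k / w = 2\<close> (\<open>SSPS_imp_jacobi\<close>; the converse is \<open>jacobi_SSPS\<close>).

  It remains to see for which \<open>r\<close> the equation \<open>2 * K k = w\<close> has a solution in \<open>(0, 1)\<close>. As \<open>K\<close> is
  continuous and strictly increasing with \<open>K 0 = pi / 2\<close> and is unbounded near \<open>1\<close>, it has exactly one
  if \<open>w > pi\<close>, that is \<open>r > pi\<^sup>2 / 2\<close>, and none otherwise.
\<close>

section \<open>Antiderivatives of continuous functions\<close>

lemma interval_integral_has_real_derivative:
  fixes g :: "real \<Rightarrow> real"
  assumes "continuous_on UNIV g"
  shows "((\<lambda>u. LBINT y=0..ereal u. g y) has_real_derivative g t) (at t)"
proof -
  let ?a = "min 0 t - 1" and ?b = "max 0 t + 1"
  have "((\<lambda>u. LBINT y=ereal 0..ereal u. g y) has_vector_derivative g t) (at t within {?a..?b})"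
    by (rule interval_integral_FTC2) (auto intro: continuous_on_subset[OF assms])
  moreover have "at t within {?a..?b} = at t"
    by (rule at_within_interior) auto
  ultimately show ?thesis
    by (simp add: has_real_derivative_iff_has_vector_derivative flip: zero_ereal_def)
qed

section \<open>Elliptic integrals of the first kind\<close>

lemma elliptic_radicand_pos:
  fixes k :: real
  assumes "0 \<le> k" "k < 1"
  shows "0 < 1 - k\<^sup>2 * (sin \<theta>)\<^sup>2"
proof -
  have "k\<^sup>2 < 1" using assms power_strict_mono[of k 1 2] by simp
  moreover have "(sin \<theta>)\<^sup>2 \<le> 1" by (simp add: abs_square_le_1)
  ultimately have "k\<^sup>2 * (sin \<theta>)\<^sup>2 < 1"
    using mult_left_le[of "(sin \<theta>)\<^sup>2" "k\<^sup>2"] by simp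
  then show ?thesis by simp
qed

lemma elliptic_F_has_derivative:
  assumes "0 \<le> k" "k < 1"
  shows "((\<lambda>\<phi>. elliptic_F \<phi> k) has_real_derivative 1 / sqrt (1 - k\<^sup>2 * (sin \<phi>)\<^sup>2)) (at \<phi>)"
  unfolding elliptic_F_def
  using elliptic_radicand_pos[OF assms]
  by (intro interval_integral_has_real_derivative continuous_intros)
     (auto simp: less_imp_neq[symmetric])

lemma elliptic_F_0: "elliptic_F 0 k = 0"
  by (simp add: elliptic_F_def zero_ereal_def[symmetric])

lemma elliptic_F_half_pi: "elliptic_F (pi / 2) k = elliptic_K k"
  by (simp add: elliptic_F_def elliptic_K_def)

lemma elliptic_F_minus:
  assumes "0 \<le> k" "k < 1"
  shows "elliptic_F (- \<phi>) k = - elliptic_F \<phi> k"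
proof -
  have "((\<lambda>\<phi>. elliptic_F \<phi> k + elliptic_F (- \<phi>) k) has_real_derivative 0) (at \<phi>)" for \<phi>
    by (auto intro!: derivative_eq_intros DERIV_chain2[OF elliptic_F_has_derivative[OF assms]]
        elliptic_F_has_derivative[OF assms])
  then have "elliptic_F \<phi> k + elliptic_F (- \<phi>) k = elliptic_F 0 k + elliptic_F (- 0) k"
    by (intro DERIV_isconst_all) auto
  then show ?thesis by (simp add: elliptic_F_0)
qed

text \<open>
  The integrand is \<open>pi\<close>-periodic, so the increment over a period is constant; it is evaluated on
  \<open>[- pi / 2, pi / 2]\<close>, where oddness makes it twice the complete integral.
\<close>

lemma elliptic_F_add_pi:
  assumes "0 \<le> k" "k < 1"
  shows "elliptic_F (\<phi> + pi) k = elliptic_F \<phi> k + 2 * elliptic_K k"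
proof -
  have "((\<lambda>\<phi>. elliptic_F (\<phi> + pi) k - elliptic_F \<phi> k) has_real_derivative 0) (at \<phi>)" for \<phi>
    by (auto intro!: derivative_eq_intros DERIV_chain2[OF elliptic_F_has_derivative[OF assms]]
        elliptic_F_has_derivative[OF assms])
  then have "elliptic_F (\<phi> + pi) k - elliptic_F \<phi> k
      = elliptic_F (- (pi / 2) + pi) k - elliptic_F (- (pi / 2)) k"
    by (intro DERIV_isconst_all) auto
  then show ?thesis
    using elliptic_F_minus[OF assms, of "pi / 2"] by (simp add: elliptic_F_half_pi)
qed

lemma elliptic_F_strict_mono:
  assumes "0 \<le> k" "k < 1" "\<phi> < \<psi>"
  shows "elliptic_F \<phi> k < elliptic_F \<psi> k"
  using assms(3)
proof (rule DERIV_pos_imp_increasing)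
  fix x
  show "\<exists>y. ((\<lambda>\<phi>. elliptic_F \<phi> k) has_real_derivative y) (at x) \<and> 0 < y"
    using elliptic_F_has_derivative[OF assms(1,2)] elliptic_radicand_pos[OF assms(1,2)]
    by (intro exI[of _ "1 / sqrt (1 - k\<^sup>2 * (sin x)\<^sup>2)"]) auto
qed

text \<open>
  The integrand is at least \<open>1\<close>. Together with oddness this makes \<open>elliptic_F\<close> unbounded in both
  directions, hence onto.
\<close>

lemma elliptic_F_ge_self:
  assumes "0 \<le> k" "k < 1" "0 \<le> \<phi>"
  shows "\<phi> \<le> elliptic_F \<phi> k"
proof -
  have "elliptic_F 0 k - 0 \<le> elliptic_F \<phi> k - \<phi>"
    using assms(3)
  proof (rule DERIV_nonneg_imp_nondecreasing)
    fix x
    let ?w = "1 - k\<^sup>2 * (sin x)\<^sup>2"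
    have "0 < sqrt ?w" "sqrt ?w \<le> 1"
      using elliptic_radicand_pos[OF assms(1,2)] by auto
    then have "1 \<le> 1 / sqrt ?w" by (simp add: field_simps)
    then show "\<exists>y. ((\<lambda>\<phi>. elliptic_F \<phi> k - \<phi>) has_real_derivative y) (at x) \<and> 0 \<le> y"
      by (intro exI[of _ "1 / sqrt ?w - 1"])
         (auto intro!: derivative_eq_intros elliptic_F_has_derivative[OF assms(1,2)])
  qed
  then show ?thesis by (simp add: elliptic_F_0)
qed

lemma elliptic_F_surj:
  assumes "0 \<le> k" "k < 1"
  shows "\<exists>\<phi>. elliptic_F \<phi> k = u"
proof -
  have "elliptic_F (- \<bar>u\<bar>) k \<le> u" "u \<le> elliptic_F \<bar>u\<bar> k"
    using elliptic_F_ge_self[OF assms, of "\<bar>u\<bar>"] elliptic_F_minus[OF assms, of "\<bar>u\<bar>"] by auto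
  moreover have "continuous_on {- \<bar>u\<bar>..\<bar>u\<bar>} (\<lambda>\<phi>. elliptic_F \<phi> k)"
    by (intro continuous_at_imp_continuous_on ballI DERIV_isCont[OF elliptic_F_has_derivative[OF assms]])
  ultimately show ?thesis
    using IVT'[of "\<lambda>\<phi>. elliptic_F \<phi> k" "- \<bar>u\<bar>" u "\<bar>u\<bar>"] by auto
qed

section \<open>The Jacobi amplitude\<close>

lemma jacobi_am_unique:
  assumes "0 \<le> k" "k < 1" "elliptic_F \<phi> k = u"
  shows "jacobi_am u k = \<phi>"
  unfolding jacobi_am_def
  by (rule the_equality) (use assms elliptic_F_strict_mono[OF assms(1,2)] in \<open>metis linorder_neqE less_irrefl\<close>)+

lemma elliptic_F_jacobi_am:
  assumes "0 \<le> k" "k < 1"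
  shows "elliptic_F (jacobi_am u k) k = u"
  using elliptic_F_surj[OF assms] jacobi_am_unique[OF assms] by metis

lemma jacobi_am_0:
  assumes "0 \<le> k" "k < 1"
  shows "jacobi_am 0 k = 0"
  by (rule jacobi_am_unique[OF assms elliptic_F_0])

lemma jacobi_am_add_2K:
  assumes "0 \<le> k" "k < 1"
  shows "jacobi_am (u + 2 * elliptic_K k) k = jacobi_am u k + pi"
  by (rule jacobi_am_unique[OF assms])
     (simp add: elliptic_F_add_pi[OF assms] elliptic_F_jacobi_am[OF assms])

lemma jacobi_am_has_derivative:
  assumes "0 \<le> k" "k < 1"
  shows "((\<lambda>u. jacobi_am u k) has_real_derivative sqrt (1 - k\<^sup>2 * (sin (jacobi_am u k))\<^sup>2)) (at u)"
proof -
  let ?F = "\<lambda>\<phi>. elliptic_F \<phi> k" and ?am = "\<lambda>u. jacobi_am u k"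
  have inv: "?am (?F \<phi>) = \<phi>" for \<phi>
    by (rule jacobi_am_unique[OF assms refl])
  have cont: "isCont ?F \<phi>" for \<phi>
    using elliptic_F_has_derivative[OF assms] DERIV_isCont by blast
  have "isCont ?am (?F (?am u))"
    by (rule isCont_inverse_function[where d=1]) (simp_all add: inv cont)
  then have "isCont ?am u" by (simp add: elliptic_F_jacobi_am[OF assms])
  then have "(?am has_real_derivative inverse (1 / sqrt (1 - k\<^sup>2 * (sin (?am u))\<^sup>2))) (at u)"
    using elliptic_radicand_pos[OF assms, of "?am u"]
    by (intro DERIV_inverse_function[where f="?F" and a="u - 1" and b="u + 1"]
        elliptic_F_has_derivative[OF assms]) (auto simp: elliptic_F_jacobi_am[OF assms])
  then show ?thesis by simp
qed

section \<open>The complete integral as a function of the modulus\<close>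

text \<open>
  Comparing the incomplete integrals through the derivative in \<open>\<phi>\<close> gives strictness directly: on
  \<open>(0, pi / 2)\<close> the integrand for \<open>l\<close> is strictly larger.
\<close>

lemma elliptic_K_strict_mono:
  assumes "0 \<le> k" "k < l" "l < 1"
  shows "elliptic_K k < elliptic_K l"
proof -
  have k: "0 \<le> k" "k < 1" and l: "0 \<le> l" "l < 1" using assms by auto
  let ?D = "\<lambda>\<phi>. elliptic_F \<phi> l - elliptic_F \<phi> k"
  have der: "(?D has_real_derivative
      1 / sqrt (1 - l\<^sup>2 * (sin x)\<^sup>2) - 1 / sqrt (1 - k\<^sup>2 * (sin x)\<^sup>2)) (at x)" for x
    by (intro derivative_intros elliptic_F_has_derivative k l)
  have "?D 0 < ?D (pi / 2)"
  proof (rule DERIV_pos_imp_increasing_open[where f="?D"])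
    fix x :: real assume x: "0 < x" "x < pi / 2"
    have "k\<^sup>2 < l\<^sup>2" using assms by (simp add: power_strict_mono)
    moreover have "0 < sin x" using x by (intro sin_gt_zero) auto
    ultimately have "k\<^sup>2 * (sin x)\<^sup>2 < l\<^sup>2 * (sin x)\<^sup>2" by simp
    then have "0 < 1 / sqrt (1 - l\<^sup>2 * (sin x)\<^sup>2) - 1 / sqrt (1 - k\<^sup>2 * (sin x)\<^sup>2)"
      using elliptic_radicand_pos[OF l, of x] by (simp add: frac_less2)
    then show "\<exists>y. (?D has_real_derivative y) (at x) \<and> 0 < y"
      using der by blast
  next
    show "continuous_on {0..pi / 2} ?D"
      by (intro continuous_at_imp_continuous_on ballI DERIV_isCont[OF der])
  qed simp
  then show ?thesis by (simp add: elliptic_F_0 elliptic_F_half_pi)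
qed

lemma elliptic_K_0: "elliptic_K 0 = pi / 2"
proof -
  have "((\<lambda>\<phi>. elliptic_F \<phi> 0 - \<phi>) has_real_derivative 0) (at \<phi>)" for \<phi>
    using elliptic_F_has_derivative[of 0 \<phi>] by (auto intro!: derivative_eq_intros)
  then have "elliptic_F (pi / 2) 0 - pi / 2 = elliptic_F 0 0 - 0"
    by (intro DERIV_isconst_all) auto
  then show ?thesis by (simp add: elliptic_F_0 elliptic_F_half_pi)
qed

text \<open>
  This makes \<open>elliptic_K\<close> unbounded as \<open>k\<close> tends to \<open>1\<close>. With \<open>e = sqrt (1 - k\<^sup>2)\<close>, the radicand is
  \<open>(cos \<theta>)\<^sup>2 + e\<^sup>2 * (sin \<theta>)\<^sup>2\<close>, and \<open>cos \<theta> \<le> pi / 2 - \<theta>\<close> bounds its root by \<open>pi / 2 - \<theta> + e\<close>. The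
  reciprocal of the latter integrates to a logarithm.
\<close>

lemma elliptic_K_ge_ln:
  assumes "0 \<le> k" "k < 1"
  shows "ln (pi / 2) - ln (sqrt (1 - k\<^sup>2)) \<le> elliptic_K k"
proof -
  define e where "e = sqrt (1 - k\<^sup>2)"
  have "k\<^sup>2 < 1" using assms power_strict_mono[of k 1 2] by simp
  then have e: "0 < e" "e\<^sup>2 = 1 - k\<^sup>2" by (auto simp: e_def)
  let ?D = "\<lambda>\<phi>. elliptic_F \<phi> k + ln (pi / 2 - \<phi> + e)"
  have "?D 0 \<le> ?D (pi / 2)"
  proof (rule DERIV_nonneg_imp_nondecreasing[where f="?D"])
    fix x :: real assume x: "0 \<le> x" "x \<le> pi / 2"
    have cos: "0 \<le> cos x" "cos x \<le> pi / 2 - x"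
      using x sin_x_le_x[of "pi / 2 - x"] by (auto simp: sin_diff intro: cos_ge_zero)
    have "(1 - k\<^sup>2 * (sin x)\<^sup>2) = (cos x)\<^sup>2 + e\<^sup>2 * (sin x)\<^sup>2"
      by (simp add: e cos_squared_eq algebra_simps)
    also have "\<dots> \<le> (cos x)\<^sup>2 + e\<^sup>2"
      by (simp add: mult_left_le abs_square_le_1)
    also have "\<dots> \<le> (pi / 2 - x)\<^sup>2 + e\<^sup>2"
      using cos by (simp add: power_mono)
    also have "\<dots> \<le> (pi / 2 - x + e)\<^sup>2"
      using x e by (simp add: power2_sum)
    finally have "sqrt (1 - k\<^sup>2 * (sin x)\<^sup>2) \<le> pi / 2 - x + e"
      using x e by (intro real_le_lsqrt) auto
    then have "0 \<le> 1 / sqrt (1 - k\<^sup>2 * (sin x)\<^sup>2) - 1 / (pi / 2 - x + e)"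
      using elliptic_radicand_pos[OF assms, of x] by (simp add: frac_le)
    moreover have "(?D has_real_derivative
        1 / sqrt (1 - k\<^sup>2 * (sin x)\<^sup>2) - 1 / (pi / 2 - x + e)) (at x)"
      using x e by (auto intro!: derivative_eq_intros elliptic_F_has_derivative[OF assms])
    ultimately show "\<exists>y. (?D has_real_derivative y) (at x) \<and> 0 \<le> y"
      by blast
  qed simp
  moreover have "ln (pi / 2) \<le> ln (pi / 2 + e)" using e by (simp add: add_pos_pos)
  ultimately show ?thesis
    by (simp add: elliptic_F_0 elliptic_F_half_pi flip: e_def)
qed

lemma elliptic_K_continuous_on:
  assumes "l < 1"
  shows "continuous_on {0..l} elliptic_K"
proof -
  have pos: "0 < 1 - k\<^sup>2 * (sin \<theta>)\<^sup>2" if "k \<in> {0..l}" for k \<theta>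
    using that assms by (intro elliptic_radicand_pos) auto
  have cont: "continuous_on {0..l} (\<lambda>k. integral (cbox 0 (pi / 2)) (\<lambda>\<theta>. 1 / sqrt (1 - k\<^sup>2 * (sin \<theta>)\<^sup>2)))"
    by (rule integral_continuous_on_param)
       (auto simp: case_prod_unfold intro!: continuous_intros dest!: pos[THEN less_imp_neq])
  have eq: "elliptic_K k = integral (cbox 0 (pi / 2)) (\<lambda>\<theta>. 1 / sqrt (1 - k\<^sup>2 * (sin \<theta>)\<^sup>2))"
    if "k \<in> {0..l}" for k
  proof -
    have "set_integrable lborel {0..pi / 2} (\<lambda>\<theta>. 1 / sqrt (1 - k\<^sup>2 * (sin \<theta>)\<^sup>2))"
      using pos[OF that]
      by (intro borel_integrable_atLeastAtMost' continuous_intros) (auto simp: less_imp_neq[symmetric])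
    then show ?thesis
      unfolding elliptic_K_def zero_ereal_def by (subst interval_integral_eq_integral) auto
  qed
  show ?thesis by (rule continuous_on_eq[OF cont eq[symmetric]])
qed

lemma elliptic_K_attains:
  assumes "pi / 2 < c"
  shows "\<exists>k\<in>{0<..<1}. elliptic_K k = c"
proof -
  \<comment> \<open>The complementary modulus for which the logarithmic lower bound equals \<open>c\<close>.\<close>
  define e where "e = (pi / 2) * exp (- c)"
  have "e < 1"
  proof -
    have "pi / 2 < c" by fact
    also have "c < exp c" using exp_ge_add_one_self[of c] by linarith
    finally show ?thesis by (simp add: e_def exp_minus field_simps)
  qed
  have "0 < e" by (simp add: e_def)
  define l where "l = sqrt (1 - e\<^sup>2)"
  have "e\<^sup>2 < 1" "0 < e\<^sup>2" using \<open>0 < e\<close> \<open>e < 1\<close> by (auto simp: abs_square_less_1 abs_less_iff)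
  then have l: "0 \<le> l" "l < 1" "sqrt (1 - l\<^sup>2) = e" using \<open>0 < e\<close> by (auto simp: l_def)
  have "c = ln (pi / 2) - ln e" by (simp only: e_def ln_mult ln_exp pi_half_gt_zero exp_gt_zero) simp
  then have "c \<le> elliptic_K l" using elliptic_K_ge_ln[OF l(1,2)] l(3) by simp
  then obtain k where k: "0 \<le> k" "k \<le> l" "elliptic_K k = c"
    using IVT'[of elliptic_K 0 c l] elliptic_K_continuous_on[OF l(2)] l assms elliptic_K_0 by auto
  moreover have "k \<noteq> 0" using k assms elliptic_K_0 by auto
  ultimately show ?thesis using l by auto
qed

section \<open>The pendulum equation\<close>

text \<open>
  The second-order equation \<open>x'' = - w\<^sup>2 * sin x\<close> as a first-order system, with \<open>p\<close> the velocity: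
  initial data, energy and antisymmetry are all statements about the pair.
\<close>

definition pendulum :: "real \<Rightarrow> (real \<Rightarrow> real) \<Rightarrow> (real \<Rightarrow> real) \<Rightarrow> bool" where
  "pendulum w x p \<longleftrightarrow> (\<forall>t. (x has_real_derivative p t) (at t) \<and>
     (p has_real_derivative - w\<^sup>2 * sin (x t)) (at t))"

text \<open>
  The bound makes \<open>D t * exp (- C * t)\<close> nonincreasing and \<open>D t * exp (C * t)\<close> nondecreasing. The
  first carries the zero forward in time, the second backward.
\<close>

lemma gronwall_zero:
  fixes D :: "real \<Rightarrow> real"
  assumes der: "\<And>t. (D has_real_derivative D' t) (at t)"
    and bound: "\<And>t. \<bar>D' t\<bar> \<le> C * D t"
    and nonneg: "\<And>t. 0 \<le> D t" and "D t0 = 0"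
  shows "D t = 0"
proof (cases "t0 \<le> t")
  case True
  have "D t * exp (- C * t) \<le> D t0 * exp (- C * t0)"
    using True
  proof (rule DERIV_nonpos_imp_nonincreasing[where f="\<lambda>t. D t * exp (- C * t)"])
    fix s
    have "((\<lambda>t. D t * exp (- C * t)) has_real_derivative (D' s - C * D s) * exp (- C * s)) (at s)"
      by (auto intro!: derivative_eq_intros der simp: algebra_simps)
    moreover have "(D' s - C * D s) * exp (- C * s) \<le> 0"
      using bound[of s] by (intro mult_nonpos_nonneg) auto
    ultimately show "\<exists>y. ((\<lambda>t. D t * exp (- C * t)) has_real_derivative y) (at s) \<and> y \<le> 0"
      by blast
  qed
  then show ?thesis using nonneg[of t] \<open>D t0 = 0\<close> by (simp add: mult_le_0_iff)
next
  case False
  then have "t \<le> t0" by simp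
  then have "D t * exp (C * t) \<le> D t0 * exp (C * t0)"
  proof (rule DERIV_nonneg_imp_nondecreasing[where f="\<lambda>t. D t * exp (C * t)"])
    fix s
    have "((\<lambda>t. D t * exp (C * t)) has_real_derivative (D' s + C * D s) * exp (C * s)) (at s)"
      by (auto intro!: derivative_eq_intros der simp: algebra_simps)
    moreover have "0 \<le> (D' s + C * D s) * exp (C * s)"
      using bound[of s] by (intro mult_nonneg_nonneg) auto
    ultimately show "\<exists>y. ((\<lambda>t. D t * exp (C * t)) has_real_derivative y) (at s) \<and> 0 \<le> y"
      by blast
  qed
  then show ?thesis using nonneg[of t] \<open>D t0 = 0\<close> by (simp add: mult_le_0_iff)
qed

text \<open>
  The squared distance in the phase plane satisfies Gronwall's differential inequality, because the
  sine is Lipschitz with constant \<open>1\<close>.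
\<close>

lemma pendulum_unique:
  assumes x: "pendulum w x p" and z: "pendulum w z q"
    and init: "x t0 = z t0" "p t0 = q t0"
  shows "x = z"
proof
  fix t
  let ?D = "\<lambda>t. (x t - z t)\<^sup>2 + (p t - q t)\<^sup>2"
  let ?D' = "\<lambda>t. 2 * ((x t - z t) * (p t - q t)) - 2 * (w\<^sup>2 * ((p t - q t) * (sin (x t) - sin (z t))))"
  have "?D t = 0"
  proof (rule gronwall_zero[where D="?D" and D'="?D'" and C="1 + w\<^sup>2" and ?t0.0=t0])
    fix t
    show "(?D has_real_derivative ?D' t) (at t)"
      using x z unfolding pendulum_def
      by (auto intro!: derivative_eq_intros simp: algebra_simps)
    let ?a = "\<bar>x t - z t\<bar>" and ?b = "\<bar>p t - q t\<bar>"
    have lip: "\<bar>sin (x t) - sin (z t)\<bar> \<le> ?a"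
    proof -
      have "\<bar>sin (x t) - sin (z t)\<bar>
          = 2 * \<bar>sin ((x t - z t) / 2)\<bar> * \<bar>cos ((x t + z t) / 2)\<bar>"
        by (simp add: sin_diff_sin abs_mult)
      also have "\<dots> \<le> 2 * \<bar>(x t - z t) / 2\<bar> * 1"
        by (intro mult_mono abs_sin_x_le_abs_x) auto
      finally show ?thesis by simp
    qed
    have "\<bar>?D' t\<bar> \<le> 2 * ?a * ?b + 2 * w\<^sup>2 * ?b * \<bar>sin (x t) - sin (z t)\<bar>"
      by (rule order_trans[OF abs_triangle_ineq4]) (simp add: abs_mult mult.assoc)
    also have "\<dots> \<le> 2 * ?a * ?b + 2 * w\<^sup>2 * ?b * ?a"
      using lip by (intro add_left_mono mult_left_mono) auto
    also have "\<dots> = (1 + w\<^sup>2) * (2 * ?a * ?b)" by (simp add: algebra_simps)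
    also have "\<dots> \<le> (1 + w\<^sup>2) * ?D t"
      using sum_squares_bound[of ?a ?b] by (intro mult_left_mono) auto
    finally show "\<bar>?D' t\<bar> \<le> (1 + w\<^sup>2) * ?D t" .
  qed (use init in auto)
  then show "x t = z t" by (simp add: sum_power2_eq_zero_iff)
qed

lemma pendulum_equilibrium:
  assumes "sin c = 0"
  shows "pendulum w (\<lambda>_. c) (\<lambda>_. 0)"
  using assms by (simp add: pendulum_def)

lemma pendulum_energy:
  assumes "pendulum w x p"
  shows "(p s)\<^sup>2 - 2 * w\<^sup>2 * cos (x s) = (p t)\<^sup>2 - 2 * w\<^sup>2 * cos (x t)"
proof (rule DERIV_isconst_all[where f="\<lambda>t. (p t)\<^sup>2 - 2 * w\<^sup>2 * cos (x t)"])
  show "\<forall>u. ((\<lambda>t. (p t)\<^sup>2 - 2 * w\<^sup>2 * cos (x t)) has_real_derivative 0) (at u)"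
    using assms unfolding pendulum_def
    by (auto intro!: derivative_eq_intros simp: algebra_simps)
qed

text \<open>
  With \<open>a\<close> the amplitude and \<open>y = arcsin (k * sin a)\<close>, both \<open>cos y\<close> and \<open>a' / w\<close> equal
  \<open>sqrt (1 - k\<^sup>2 * (sin a)\<^sup>2)\<close>. So \<open>y' = k * cos a * a' / cos y\<close> collapses to \<open>k * w * cos a\<close>, and
  differentiating again gives \<open>y'' = - w\<^sup>2 * sin y * cos y\<close>, the pendulum equation for \<open>2 * y\<close>.
\<close>

lemma pendulum_jacobi:
  assumes "0 \<le> k" "k < 1"
  shows "pendulum w (\<lambda>t. 2 * arcsin (k * jacobi_sn (w * (t + \<tau>)) k))
           (\<lambda>t. 2 * k * w * cos (jacobi_am (w * (t + \<tau>)) k))"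
  unfolding pendulum_def
proof (intro allI conjI)
  fix t
  let ?am = "\<lambda>t. jacobi_am (w * (t + \<tau>)) k"
  let ?d = "sqrt (1 - k\<^sup>2 * (sin (?am t))\<^sup>2)"
  have d: "0 < ?d" using elliptic_radicand_pos[OF assms] by simp
  have am: "(?am has_real_derivative w * ?d) (at t)"
    by (rule DERIV_cong[OF DERIV_chain2[OF jacobi_am_has_derivative[OF assms],
            where g="\<lambda>t. w * (t + \<tau>)" and x=t and Db=w]])
       (auto intro!: derivative_eq_intros)
  have "\<bar>k * sin (?am t)\<bar> < 1"
    using elliptic_radicand_pos[OF assms, of "?am t"] 
    by (simp add: abs_square_less_1 flip: power_mult_distrib)
  then have bd: "-1 < k * sin (?am t)" "k * sin (?am t) < 1" by auto
  show "((\<lambda>t. 2 * arcsin (k * jacobi_sn (w * (t + \<tau>)) k)) has_real_derivative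
      2 * k * w * cos (?am t)) (at t)"
    unfolding jacobi_sn_def
    by (rule derivative_eq_intros am refl bd)+ (use d in \<open>simp add: power_mult_distrib\<close>)
  have "sin (2 * arcsin (k * jacobi_sn (w * (t + \<tau>)) k)) = 2 * k * sin (?am t) * ?d"
    using bd by (simp add: sin_double jacobi_sn_def cos_arcsin power_mult_distrib)
  then show "((\<lambda>t. 2 * k * w * cos (?am t)) has_real_derivative
      - w\<^sup>2 * sin (2 * arcsin (k * jacobi_sn (w * (t + \<tau>)) k))) (at t)"
    by (auto intro!: derivative_eq_intros am simp: power2_eq_square)
qed

text \<open>
  A period of \<open>x\<close> is also one of its velocity, which is proportional to the cosine of the amplitude.
  At the time where the amplitude is \<open>0\<close> this forces the amplitude one period later to be a positive
  multiple of \<open>2 * pi\<close>, which is first reached after \<open>4 * K k / w\<close>.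
\<close>

lemma jacobi_pendulum_minimal_period:
  assumes "0 < k" "k < 1" "0 < w"
  shows "minimal_period (\<lambda>t. 2 * arcsin (k * jacobi_sn (w * (t + \<tau>)) k)) (4 * elliptic_K k / w)"
    (is "minimal_period ?x _")
proof -
  have k: "0 \<le> k" "k < 1" using assms by auto
  have K: "0 < elliptic_K k"
    using elliptic_K_strict_mono[of 0 k] assms elliptic_K_0 by (auto intro: less_trans[of _ "pi/2"])
  let ?am = "\<lambda>t. jacobi_am (w * (t + \<tau>)) k"
  let ?p = "\<lambda>t. 2 * k * w * cos (?am t)"
  have shift: "jacobi_am (u + 4 * elliptic_K k) k = jacobi_am u k + 2 * pi" for u
    using jacobi_am_add_2K[OF k, of u] jacobi_am_add_2K[OF k, of "u + 2 * elliptic_K k"]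
    by (simp add: algebra_simps)
  have "w * (t + 4 * elliptic_K k / w + \<tau>) = w * (t + \<tau>) + 4 * elliptic_K k" for t
    using \<open>0 < w\<close> by (simp add: field_simps)
  then have "is_period ?x (4 * elliptic_K k / w)"
    using K \<open>0 < w\<close> by (simp add: is_period_def jacobi_sn_def shift)
  moreover have "4 * elliptic_K k / w \<le> q" if q: "is_period ?x q" for q
  proof -
    have "0 < q" and per: "?x (t + q) = ?x t" for t using q by (auto simp: is_period_def)
    have der: "(?x has_real_derivative ?p t) (at t)" for t
      using pendulum_jacobi[OF k, of w \<tau>] by (simp add: pendulum_def)
    have "((\<lambda>t. ?x (t + q)) has_real_derivative ?p (t + q)) (at t)" for t
      by (rule DERIV_cong[OF DERIV_chain2[OF der, where g="\<lambda>t. t + q" and x=t and Db=1]])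
         (auto intro!: derivative_eq_intros)
    then have "?p (t + q) = ?p t" for t
      unfolding per using der DERIV_unique by blast
    from this[of "- \<tau>"] have "cos (jacobi_am (w * q) k) = 1"
      using assms by (simp add: jacobi_am_0[OF k])
    then obtain n :: int where n: "jacobi_am (w * q) k = of_int n * 2 * pi"
      by (auto simp: cos_one_2pi_int)
    have "elliptic_F 0 k < elliptic_F (jacobi_am (w * q) k) k"
      using \<open>0 < q\<close> \<open>0 < w\<close> by (simp add: elliptic_F_0 elliptic_F_jacobi_am[OF k])
    then have "0 < jacobi_am (w * q) k"
      using elliptic_F_strict_mono[OF k] by (metis less_irrefl less_asym linorder_neqE)
    then have "1 \<le> n" using n by (simp add: zero_less_mult_iff)
    then have le: "2 * pi \<le> jacobi_am (w * q) k" using n by simp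
    have "elliptic_F (2 * pi) k = 4 * elliptic_K k"
      using elliptic_F_jacobi_am[OF k, of "0 + 4 * elliptic_K k"] unfolding shift
      by (simp add: jacobi_am_0[OF k])
    then have "4 * elliptic_K k \<le> w * q"
      using le elliptic_F_strict_mono[OF k, of "2 * pi" "jacobi_am (w * q) k"]
      by (auto simp: elliptic_F_jacobi_am[OF k] le_less)
    then show ?thesis using \<open>0 < w\<close> by (simp add: field_simps)
  qed
  ultimately show ?thesis by (simp add: minimal_period_def)
qed

section \<open>Special symmetric periodic solutions\<close>

text \<open>
  The velocity is minus the increment over \<open>[t - 1, t]\<close> of an antiderivative of \<open>r * sin (x t)\<close>. Its
  derivative involves only the two end points, where antisymmetry doubles the term \<open>r * sin (x t)\<close>.
\<close>

lemma SSPS_imp_pendulum: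
  assumes "0 < r" and x: "SSPS (\<lambda>y. r * sin y) x"
  shows "\<exists>p. pendulum (sqrt (2 * r)) x p"
proof -
  have anti: "x (t - 1) = - x t" for t using x by (simp add: SSPS_def eq_neg_iff_add_eq_0 add.commute)
  let ?g = "\<lambda>t. r * sin (x t)"
  let ?G = "\<lambda>t. LBINT u=0..ereal t. ?g u"
  have dx: "(x has_real_derivative - integral {0..1} (\<lambda>s. ?g (t - s))) (at t)" for t
    using x by (simp add: SSPS_def solves_dde_def)
  then have "continuous_on UNIV x"
    by (meson DERIV_isCont continuous_at_imp_continuous_on)
  then have "continuous_on UNIV ?g" by (intro continuous_intros)
  then have dG: "(?G has_real_derivative ?g t) (at t)" for t
    by (rule interval_integral_has_real_derivative)
  have int: "integral {0..1} (\<lambda>s. ?g (t - s)) = ?G t - ?G (t - 1)" for t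
  proof -
    have "((\<lambda>s. ?G (t - s)) has_real_derivative - ?g (t - s)) (at s)" for s
      by (rule DERIV_cong[OF DERIV_chain2[OF dG, where g="\<lambda>s. t - s" and x=s and Db="-1"]])
         (auto intro!: derivative_eq_intros)
    from DERIV_minus[OF this]
    have "((\<lambda>s. - ?G (t - s)) has_real_derivative ?g (t - s)) (at s)" for s by simp
    then have "((\<lambda>s. ?g (t - s)) has_integral (- ?G (t - 1) - - ?G (t - 0))) {0..1}"
      by (intro fundamental_theorem_of_calculus)
         (auto simp flip: has_real_derivative_iff_has_vector_derivative intro: DERIV_subset)
    then have "integral {0..1} (\<lambda>s. ?g (t - s)) = - ?G (t - 1) - - ?G (t - 0)"
      by (rule integral_unique)
    then show ?thesis by simp
  qed
  have "((\<lambda>t. ?G (t - 1)) has_real_derivative ?g (t - 1)) (at t)" for t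
    by (rule DERIV_cong[OF DERIV_chain2[OF dG, where g="\<lambda>t. t - 1" and x=t and Db=1]])
       (auto intro!: derivative_eq_intros)
  then have "((\<lambda>t. - (?G t - ?G (t - 1))) has_real_derivative - (?g t - ?g (t - 1))) (at t)" for t
    by (intro derivative_intros dG)
  then have "pendulum (sqrt (2 * r)) x (\<lambda>t. - (?G t - ?G (t - 1)))"
    using dx \<open>0 < r\<close> unfolding pendulum_def int by (simp add: anti mult.assoc)
  then show ?thesis by blast
qed

text \<open>
  Here \<open>- p / 2\<close> is an antiderivative of \<open>r * sin (x t)\<close>, so the delayed integral is
  \<open>(p (t - 1) - p t) / 2\<close>.
\<close>

lemma pendulum_imp_solves_dde:
  assumes "0 < r" and x: "pendulum (sqrt (2 * r)) x p" and anti: "\<And>t. p (t - 1) = - p t"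
  shows "solves_dde (\<lambda>y. r * sin y) x"
  unfolding solves_dde_def
proof
  fix t
  have dp: "(p has_real_derivative - 2 * r * sin (x t)) (at t)" for t
    using x \<open>0 < r\<close> by (simp add: pendulum_def)
  have "((\<lambda>s. p (t - s)) has_real_derivative 2 * r * sin (x (t - s))) (at s)" for s
    by (rule DERIV_cong[OF DERIV_chain2[OF dp, where g="\<lambda>s. t - s" and x=s and Db="-1"]])
         (auto intro!: derivative_eq_intros)
  from DERIV_cdivide[OF this, where c=2]
  have "((\<lambda>s. p (t - s) / 2) has_real_derivative r * sin (x (t - s))) (at s)" for s by simp
  then have "((\<lambda>s. r * sin (x (t - s))) has_integral (p (t - 1) / 2 - p (t - 0) / 2)) {0..1}"
    by (intro fundamental_theorem_of_calculus)
       (auto simp flip: has_real_derivative_iff_has_vector_derivative intro: DERIV_subset)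
  then have "integral {0..1} (\<lambda>s. r * sin (x (t - s))) = p (t - 1) / 2 - p (t - 0) / 2"
    by (rule integral_unique)
  then have "- integral {0..1} (\<lambda>s. r * sin (x (t - s))) = p t"
    by (simp add: anti)
  then show "(x has_real_derivative - integral {0..1} (\<lambda>s. r * sin (x (t - s)))) (at t)"
    using x by (simp add: pendulum_def)
qed

text \<open>
  The condition on \<open>k\<close> says that a unit of time is the half-period, over which the amplitude grows by
  \<open>pi\<close>. This reverses the signs of the sine and the cosine of the amplitude, hence of position and
  velocity.
\<close>

lemma jacobi_SSPS:
  assumes "0 < r" "0 < k" "k < 1" and K: "2 * elliptic_K k = sqrt (2 * r)"
  shows "SSPS (\<lambda>y. r * sin y) (\<lambda>t. 2 * arcsin (k * jacobi_sn (sqrt (2 * r) * (t + \<tau>)) k))"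
    (is "SSPS _ ?x")
proof -
  let ?w = "sqrt (2 * r)"
  have w: "0 < ?w" using assms by simp
  have k: "0 \<le> k" "k < 1" using assms by auto
  have am: "jacobi_am (?w * (t - 1 + \<tau>)) k = jacobi_am (?w * (t + \<tau>)) k - pi" for t
    using jacobi_am_add_2K[OF k, of "?w * (t - 1 + \<tau>)"] unfolding K by (simp add: algebra_simps)
  have "solves_dde (\<lambda>y. r * sin y) ?x"
    by (rule pendulum_imp_solves_dde[OF \<open>0 < r\<close> pendulum_jacobi[OF k]]) (simp add: am)
  moreover have "4 * elliptic_K k / ?w = 2" using K w by (simp add: field_simps)
  then have "minimal_period ?x 2"
    using jacobi_pendulum_minimal_period[OF assms(2,3) w, of \<tau>] by simp
  moreover have "?x t + ?x (t - 1) = 0" for t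
  proof -
    have "\<bar>k * sin (jacobi_am (?w * (t + \<tau>)) k)\<bar> \<le> 1"
      using assms by (simp add: abs_mult mult_le_one)
    then show ?thesis unfolding jacobi_sn_def am by (simp add: arcsin_minus)
  qed
  ultimately show ?thesis by (simp add: SSPS_def)
qed

text \<open>
  The solution is matched with an explicit one at an upward zero crossing; the modulus is read off
  from the velocity there.
\<close>

lemma SSPS_imp_jacobi:
  assumes "0 < r" and x: "SSPS (\<lambda>y. r * sin y) x"
  shows "\<exists>k \<tau>. k \<in> {0<..<1} \<and> 2 * elliptic_K k = sqrt (2 * r) \<and>
    x = (\<lambda>t. 2 * arcsin (k * jacobi_sn (sqrt (2 * r) * (t + \<tau>)) k))"
proof -
  let ?w = "sqrt (2 * r)"
  have w: "0 < ?w" using assms by simp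
  obtain p where pen: "pendulum ?w x p" using SSPS_imp_pendulum[OF assms] by blast
  then have dx: "(x has_real_derivative p t) (at t)" for t by (simp add: pendulum_def)
  have min: "minimal_period x 2" and anti: "x (t - 1) = - x t" for t
    using x by (auto simp: SSPS_def eq_neg_iff_add_eq_0 add.commute)
  have nonconst: "x \<noteq> (\<lambda>_. c)" for c
  proof
    assume "x = (\<lambda>_. c)"
    then have "is_period x 1" by (simp add: is_period_def)
    then show False using min by (auto simp: minimal_period_def)
  qed
  \<comment> \<open>The solution never rests at an equilibrium of the pendulum, since it would then be constant.\<close>
  have not_eq: "p t \<noteq> 0" if "sin (x t) = 0" for t
    using pendulum_unique[OF pen pendulum_equilibrium[OF that], of t] nonconst by auto
  have contx: "isCont x t" for t using dx DERIV_isCont by blast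
  have p_anti: "p (t - 1) = - p t" for t
  proof -
    have "((\<lambda>t. x (t - 1)) has_real_derivative p (t - 1)) (at t)"
      by (rule DERIV_cong[OF DERIV_chain2[OF dx, where g="\<lambda>t. t - 1" and x=t and Db=1]])
         (auto intro!: derivative_eq_intros)
    moreover have "((\<lambda>t. x (t - 1)) has_real_derivative - p t) (at t)"
      unfolding anti by (intro derivative_intros dx)
    ultimately show ?thesis by (rule DERIV_unique)
  qed
  obtain t1 where t1: "x t1 = 0"
  proof -
    have "x (-1) = - x 0" using anti[of 0] by simp
    then have "(x (-1) \<le> 0 \<and> 0 \<le> x 0) \<or> (x 0 \<le> 0 \<and> 0 \<le> x (-1))" by linarith
    then show ?thesis
      using IVT[of x "-1" 0 0] IVT2[of x 0 0 "-1"] contx that by auto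
  qed
  obtain t0 where t0: "x t0 = 0" "0 < p t0"
  proof (cases "0 < p t1")
    case False
    then have "0 < p (t1 - 1)" using not_eq[of t1] t1 p_anti[of t1] by simp
    then show ?thesis using that[of "t1 - 1"] anti[of t1] t1 by simp
  qed (use t1 that in auto)
  \<comment> \<open>The explicit solution with modulus \<open>k\<close> crosses \<open>0\<close> with velocity \<open>2 * k * w\<close>.\<close>
  define k where "k = p t0 / (2 * ?w)"
  have "0 < k" using t0 w by (simp add: k_def)
  have pk: "p t0 = 2 * k * ?w" using w by (simp add: k_def)
  have "k < 1"
  proof -
    have "x 0 = x 2" using min by (metis add_0 is_period_def minimal_period_def)
    then obtain z where "p z = 0"
      using Rolle[of 0 2 x] dx contx
      by (metis DERIV_unique continuous_at_imp_continuous_on real_differentiable_def zero_less_numeral)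
    then have "4 * k\<^sup>2 * ?w\<^sup>2 = 2 * ?w\<^sup>2 * (1 - cos (x z))"
      using pendulum_energy[OF pen, of t0 z] unfolding pk
      by (simp add: t0 power_mult_distrib algebra_simps)
    then have "2 * k\<^sup>2 = 1 - cos (x z)" using w by simp
    \<comment> \<open>This excludes the separatrix \<open>k = 1\<close>: a turning point there is the upper equilibrium.\<close>
    moreover have "cos (x z) \<noteq> -1"
      using not_eq[of z] \<open>p z = 0\<close> sin_squared_eq[of "x z"] by auto
    moreover have "-1 \<le> cos (x z)" by simp
    ultimately have "k\<^sup>2 < 1" by linarith
    then show ?thesis by (simp add: abs_square_less_1 abs_less_iff)
  qed
  have k: "0 \<le> k" "k < 1" using \<open>0 < k\<close> \<open>k < 1\<close> by auto
  have eq: "x = (\<lambda>t. 2 * arcsin (k * jacobi_sn (?w * (t + - t0)) k))"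
    by (rule pendulum_unique[OF pen pendulum_jacobi[OF k], of t0])
       (simp_all add: t0 pk jacobi_sn_def jacobi_am_0[OF k])
  then have "minimal_period x (4 * elliptic_K k / ?w)"
    using jacobi_pendulum_minimal_period[OF \<open>0 < k\<close> \<open>k < 1\<close> w, of "- t0"] by simp
  then have "4 * elliptic_K k / ?w = 2"
    using min unfolding minimal_period_def by (meson order_antisym)
  then have "2 * elliptic_K k = ?w" using w by (simp add: field_simps)
  then show ?thesis using eq k \<open>0 < k\<close> by (intro exI[of _ k] exI[of _ "- t0"]) auto
qed

lemma pi_less_sqrt_double_iff:
  assumes "0 < r"
  shows "pi < sqrt (2 * r) \<longleftrightarrow> pi\<^sup>2 / 2 < r"
  using real_less_rsqrt real_sqrt_less_iff[of "pi\<^sup>2" "2 * r"] by (auto simp: field_simps)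

theorem theorem11:
  fixes r :: real and f :: "real \<Rightarrow> real"
  assumes "r > 0" and "f = (\<lambda>y. r * sin y)"
  shows "((\<exists>x. SSPS f x) \<longleftrightarrow> r > pi\<^sup>2 / 2) \<and>
    (r > pi\<^sup>2 / 2 \<longrightarrow>
      (\<exists>!k. k \<in> {0<..<1} \<and> 2 * elliptic_K k / sqrt (2 * r) = 1) \<and>
      (\<forall>k. k \<in> {0<..<1} \<and> 2 * elliptic_K k / sqrt (2 * r) = 1 \<longrightarrow>
        (\<forall>x. SSPS f x \<longleftrightarrow>
          (\<exists>\<tau>. \<forall>t. x t = 2 * arcsin (k * jacobi_sn (sqrt (2 * r) * (t + \<tau>)) k)))))"
proof -
  let ?w = "sqrt (2 * r)"
  have w: "2 * elliptic_K k / ?w = 1 \<longleftrightarrow> 2 * elliptic_K k = ?w" for k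
    using \<open>r > 0\<close> by (simp add: divide_eq_eq)
  have unique: "k = l" if "k \<in> {0<..<1}" "l \<in> {0<..<1}" "elliptic_K k = elliptic_K l" for k l
    using that elliptic_K_strict_mono[of k l] elliptic_K_strict_mono[of l k]
    by (cases k l rule: linorder_cases) auto
  have exists: "\<exists>k. k \<in> {0<..<1} \<and> 2 * elliptic_K k = ?w" if "r > pi\<^sup>2 / 2"
    using elliptic_K_attains[of "?w / 2"] pi_less_sqrt_double_iff[OF \<open>r > 0\<close>] that by auto
  have large: "r > pi\<^sup>2 / 2" if "k \<in> {0<..<1}" "2 * elliptic_K k = ?w" for k
    using that elliptic_K_strict_mono[of 0 k] elliptic_K_0 pi_less_sqrt_double_iff[OF \<open>r > 0\<close>] by auto
  have explicit: "SSPS f x \<longleftrightarrow> (\<exists>\<tau>. \<forall>t. x t = 2 * arcsin (k * jacobi_sn (?w * (t + \<tau>)) k))"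
    if k: "k \<in> {0<..<1}" "2 * elliptic_K k = ?w" for k x
  proof
    assume "SSPS f x"
    then obtain l \<tau> where l: "l \<in> {0<..<1}" "2 * elliptic_K l = ?w"
      and x: "x = (\<lambda>t. 2 * arcsin (l * jacobi_sn (?w * (t + \<tau>)) l))"
      using SSPS_imp_jacobi[OF \<open>r > 0\<close>, of x] assms(2) by blast
    have "l = k" using unique[OF l(1) k(1)] l(2) k(2) by simp
    then show "\<exists>\<tau>. \<forall>t. x t = 2 * arcsin (k * jacobi_sn (?w * (t + \<tau>)) k)" using x by auto
  next
    assume "\<exists>\<tau>. \<forall>t. x t = 2 * arcsin (k * jacobi_sn (?w * (t + \<tau>)) k)"
    then obtain \<tau> where "x = (\<lambda>t. 2 * arcsin (k * jacobi_sn (?w * (t + \<tau>)) k))" by blast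
    then show "SSPS f x" using jacobi_SSPS[OF \<open>r > 0\<close> _ _ k(2), of \<tau>] k(1) assms(2) by simp
  qed
  have "(\<exists>x. SSPS f x) \<longleftrightarrow> r > pi\<^sup>2 / 2"
  proof
    assume "\<exists>x. SSPS f x"
    then obtain x where "SSPS (\<lambda>y. r * sin y) x" using assms(2) by blast
    then show "r > pi\<^sup>2 / 2" using SSPS_imp_jacobi[OF \<open>r > 0\<close>, of x] large by blast
  next
    assume "r > pi\<^sup>2 / 2"
    then obtain k where "k \<in> {0<..<1}" "2 * elliptic_K k = ?w" using exists by blast
    then have "SSPS f (\<lambda>t. 2 * arcsin (k * jacobi_sn (?w * (t + 0)) k))" using explicit by blast
    then show "\<exists>x. SSPS f x" by blast
  qed
  moreover have "\<exists>!k. k \<in> {0<..<1} \<and> 2 * elliptic_K k = ?w" if "r > pi\<^sup>2 / 2"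
  proof (rule ex_ex1I)
    show "k = l" if "k \<in> {0<..<1} \<and> 2 * elliptic_K k = ?w" "l \<in> {0<..<1} \<and> 2 * elliptic_K l = ?w"
      for k l using unique[of k l] that by auto
  qed (rule exists[OF that])
  ultimately show ?thesis unfolding w using explicit by blast
qed

end
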